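(* For every $w\in W$ with a fixed reduced decomposition $w=s_{i_1}\cdots s_{i_t}$ and every subset $\Delta\subseteq\{1,\dots,t\}$, there is an isomorphism of $\mathbb{Q}$-vector spaces $$\ker(M(w^\Delta))\simeq\ker(w+w^\Delta),$$ where $M(w^\Delta)$ is regarded as a linear map $\mathbb{Q}^m\to\mathbb{Q}^m$ and $w+w^\Delta$ as a linear map $V\to V$.
   Context: $\mathfrak g$ is a simple complex Lie algebra of rank $n$ with simple roots $\alpha_1,\dots,\alpha_n$, a basis of a Euclidean space with $W$-invariant inner product $\langle\cdot|\cdot\rangle$ normalised so that short roots have length $\sqrt2$; $W$ is the Weyl group, generated by the simple reflections $s_i=s_{\alpha_i}$. For a root $\alpha$, $\alpha^\vee=2\alpha/\langle\alpha|\alpha\rangle$; the fundamental weights $\varpi_j$ are defined by $\langle\varpi_j|\alpha_i^\vee\rangle=\delta_{ij}$; $V=\bigoplus_{i=1}^n\mathbb{Q}\varpi_i$, on which $W$ acts. For $w=s_{i_1}\cdots s_{i_t}$ reduced ($t=l(w)$), put $\beta_k=s_{i_1}\cdots s_{i_{k-1}}(\alpha_{i_k})$ for $1\le k\le t$. For $\Delta\subseteq\{1,\dots,t\}$ write $\{t_1<\cdots<t_m\}=\{1,\dots,t\}\setminus\Delta$; put $s_{i_k}^\Delta=s_{i_k}$ if $k\in\Delta$ and $s_{i_k}^\Delta=\mathrm{id}$ otherwise, and $w^\Delta=s_{i_1}^\Delta\cdots s_{i_t}^\Delta\in W$. $M(w^\Delta)$ is the $m\times m$ skew-symmetric matrix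 whose $(i,\ell)$-entry, for $i<\ell$, is $\langle\beta_{t_i}|\beta_{t_\ell}\rangle$. *)

theory Defs
  imports "HOL-Analysis.Euclidean_Space" "Jordan_Normal_Form.Matrix_Kernel"
begin

section \<open>Simple complex Lie algebras and their roots\<close>

locale complex_lie_algebra = Vector_Spaces.vector_space scale
  for scale :: "complex \<Rightarrow> 'g::ab_group_add \<Rightarrow> 'g" +
  fixes lie :: "'g \<Rightarrow> 'g \<Rightarrow> 'g"
  assumes finite_dim: "\<exists>B. finite B \<and> span B = UNIV"
    and lie_add_left: "lie (x + y) z = lie x z + lie y z"
    and lie_add_right: "lie z (x + y) = lie z x + lie z y"
    and lie_scale_left: "lie (scale c x) y = scale c (lie x y)"
    and lie_scale_right: "lie x (scale c y) = scale c (lie x y)"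
    and lie_self: "lie x x = 0"
    and jacobi: "lie x (lie y z) + lie y (lie z x) + lie z (lie x y) = 0"
begin

definition ideal :: "'g set \<Rightarrow> bool" where
  "ideal I \<longleftrightarrow> subspace I \<and> (\<forall>x. \<forall>y\<in>I. lie x y \<in> I)"

definition simple :: bool where
  "simple \<longleftrightarrow> (\<exists>x y. lie x y \<noteq> 0) \<and> (\<forall>I. ideal I \<longrightarrow> I = {0} \<or> I = UNIV)"

definition weight_space :: "'g set \<Rightarrow> ('g \<Rightarrow> complex) \<Rightarrow> 'g set" where
  "weight_space H \<mu> = {x. \<forall>h\<in>H. lie h x = scale (\<mu> h) x}"

definition toral :: "'g set \<Rightarrow> bool" where
  "toral H \<longleftrightarrow> subspace H \<and> (\<forall>x\<in>H. \<forall>y\<in>H. lie x y = 0) \<and>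
     span (\<Union>\<mu>. weight_space H \<mu>) = UNIV"

text \<open>For semisimple complex Lie algebras the Cartan subalgebras are exactly the subalgebras
  that are maximal among the abelian ones whose adjoint action is (simultaneously)
  diagonalisable; this is used as the definition.\<close>

definition cartan :: "'g set \<Rightarrow> bool" where
  "cartan H \<longleftrightarrow> toral H \<and> (\<forall>H'. toral H' \<and> H \<subseteq> H' \<longrightarrow> H' = H)"

text \<open>An element of the dual space of H is represented by a function on the whole Lie algebra
  that vanishes outside H; on H a root is automatically linear, its weight space being
  nonzero.\<close>

definition roots :: "'g set \<Rightarrow> ('g \<Rightarrow> complex) set" where
  "roots H = {\<mu>. (\<forall>x. x \<notin> H \<longrightarrow> \<mu> x = 0) \<and> (\<exists>x\<in>H. \<mu> x \<noteq> 0) \<and> weight_space H \<mu> \<noteq> {0}}"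

end

section \<open>The Euclidean space of the root system\<close>

definition coroot :: "'e::euclidean_space \<Rightarrow> 'e" where
  "coroot a = (2 / inner a a) *\<^sub>R a"

definition reflection :: "'e::euclidean_space \<Rightarrow> 'e \<Rightarrow> 'e" where
  "reflection a x = x - inner x (coroot a) *\<^sub>R a"

text \<open>The type \<open>'e\<close> is the Euclidean space spanned by the roots. The injective real-linear map
  \<open>ev\<close> sends a vector of \<open>'e\<close> to the functional on H that it stands for, so \<open>'e\<close> is identified
  with a real subspace of the dual of H, and \<open>ev -` roots H\<close> is the set of roots as vectors
  of \<open>'e\<close>. Finite index types \<open>'i\<close> label the simple roots, so the rank is \<open>CARD('i)\<close>.

  Invariance of the inner product under the Weyl group means that the reflection in a root,
  taken in the Weyl group, is the orthogonal one. As there is at most one linear map permuting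
  the (finite, spanning) set of roots, negating a given root and fixing a hyperplane pointwise,
  this says precisely that the orthogonal reflections permute the roots. Short roots are those
  of minimal length, so all roots are short in the simply laced case.\<close>

locale simple_lie_roots = complex_lie_algebra scale lie
  for scale :: "complex \<Rightarrow> 'g::ab_group_add \<Rightarrow> 'g" and lie :: "'g \<Rightarrow> 'g \<Rightarrow> 'g" +
  fixes H :: "'g set"
    and ev :: "'e::euclidean_space \<Rightarrow> 'g \<Rightarrow> complex"
    and \<alpha> :: "'i::finite \<Rightarrow> 'e"
  assumes simple: "simple"
    and cartan: "cartan H"
    and ev_add: "ev (x + y) h = ev x h + ev y h"
    and ev_scaleR: "ev (r *\<^sub>R x) h = complex_of_real r * ev x h"
    and ev_inj: "inj ev"
    and roots_in_range: "roots H \<subseteq> range ev"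
    and simple_roots: "range \<alpha> \<subseteq> ev -` roots H"
    and simple_inj: "inj \<alpha>"
    and simple_independent: "\<not> real_vector.dependent (range \<alpha>)"
    and simple_spanning: "real_vector.span (range \<alpha>) = UNIV"
    and simple_base: "ev b \<in> roots H \<Longrightarrow>
      \<exists>c :: 'i \<Rightarrow> nat. b = (\<Sum>i\<in>UNIV. real (c i) *\<^sub>R \<alpha> i) \<or> b = - (\<Sum>i\<in>UNIV. real (c i) *\<^sub>R \<alpha> i)"
    and weyl_invariant: "ev a \<in> roots H \<Longrightarrow> ev b \<in> roots H \<Longrightarrow> ev (reflection a b) \<in> roots H"
    and short_exists: "\<exists>a. ev a \<in> roots H \<and> norm a = sqrt 2"
    and short_minimal: "ev a \<in> roots H \<Longrightarrow> norm a \<ge> sqrt 2"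

section \<open>Weyl group, weights and reduced decompositions\<close>

inductive_set weyl_group :: "('i \<Rightarrow> 'e::euclidean_space) \<Rightarrow> ('e \<Rightarrow> 'e) set"
  for \<alpha> :: "'i \<Rightarrow> 'e" where
  one: "id \<in> weyl_group \<alpha>"
| mult: "w \<in> weyl_group \<alpha> \<Longrightarrow> reflection (\<alpha> i) \<circ> w \<in> weyl_group \<alpha>"

definition fundamental_weight :: "('i \<Rightarrow> 'e::euclidean_space) \<Rightarrow> 'i \<Rightarrow> 'e" where
  "fundamental_weight \<alpha> j = (THE v. \<forall>i. inner v (coroot (\<alpha> i)) = (if i = j then 1 else 0))"

definition weight_rat_space :: "('i::finite \<Rightarrow> 'e::euclidean_space) \<Rightarrow> 'e set" where
  "weight_rat_space \<alpha> =
     {\<Sum>j\<in>UNIV. real_of_rat (c j) *\<^sub>R fundamental_weight \<alpha> j | c :: 'i \<Rightarrow> rat. True}"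

definition compose_list :: "('e \<Rightarrow> 'e) list \<Rightarrow> 'e \<Rightarrow> 'e" where
  "compose_list fs = foldr (\<circ>) fs id"

definition word_elem :: "('i \<Rightarrow> 'e::euclidean_space) \<Rightarrow> 'i list \<Rightarrow> 'e \<Rightarrow> 'e" where
  "word_elem \<alpha> js = compose_list (map (\<lambda>i. reflection (\<alpha> i)) js)"

definition weyl_length :: "('i \<Rightarrow> 'e::euclidean_space) \<Rightarrow> ('e \<Rightarrow> 'e) \<Rightarrow> nat" where
  "weyl_length \<alpha> w = (LEAST k. \<exists>js. length js = k \<and> word_elem \<alpha> js = w)"

definition reduced_decomposition ::
  "('i \<Rightarrow> 'e::euclidean_space) \<Rightarrow> ('e \<Rightarrow> 'e) \<Rightarrow> 'i list \<Rightarrow> bool" where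
  "reduced_decomposition \<alpha> w js \<longleftrightarrow> word_elem \<alpha> js = w \<and> length js = weyl_length \<alpha> w"

text \<open>Positions in a word are counted from 1, whereas \<open>(!)\<close> counts from 0.\<close>

definition beta :: "('i \<Rightarrow> 'e::euclidean_space) \<Rightarrow> 'i list \<Rightarrow> nat \<Rightarrow> 'e" where
  "beta \<alpha> js k = word_elem \<alpha> (take (k - 1) js) (\<alpha> (js ! (k - 1)))"

definition sub_elem :: "('i \<Rightarrow> 'e::euclidean_space) \<Rightarrow> 'i list \<Rightarrow> nat set \<Rightarrow> 'e \<Rightarrow> 'e" where
  "sub_elem \<alpha> js \<Delta> =
     compose_list (map (\<lambda>k. if k \<in> \<Delta> then reflection (\<alpha> (js ! (k - 1))) else id)
       [1..<length js + 1])"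

text \<open>The entries are real by type; that they are rational (so that the matrix acts on rational
  vectors) depends on the normalisation of the inner product and on simplicity.\<close>

definition skew_matrix :: "('i \<Rightarrow> 'e::euclidean_space) \<Rightarrow> 'i list \<Rightarrow> nat set \<Rightarrow> real mat" where
  "skew_matrix \<alpha> js \<Delta> =
     (let ts = sorted_list_of_set ({1..length js} - \<Delta>); m = length ts
      in mat m m (\<lambda>(i, l).
           if i < l then inner (beta \<alpha> js (ts ! i)) (beta \<alpha> js (ts ! l))
           else if l < i then - inner (beta \<alpha> js (ts ! l)) (beta \<alpha> js (ts ! i))
           else 0))"

section \<open>Isomorphism of rational vector spaces\<close>

definition rat_isomorphic :: "rat Matrix.vec set \<Rightarrow> 'e::real_vector set \<Rightarrow> bool" where
  "rat_isomorphic A B \<longleftrightarrow> (\<exists>f. bij_betw f A B \<and>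
     (\<forall>u\<in>A. \<forall>v\<in>A. f (u + v) = f u + f v) \<and>
     (\<forall>q. \<forall>u\<in>A. f (q \<cdot>\<^sub>v u) = real_of_rat q *\<^sub>R f u))"

end

theory Submission
  imports Defs
begin

text \<open>Write \<open>b\<^sub>1, \<dots>, b\<^sub>m\<close> for the roots \<open>\<beta>\<^sub>k\<close> at the deleted positions \<open>k\<close>, in increasing order.
  Deleting the last of these letters multiplies \<open>w\<close> on the left by the reflection in \<open>b\<^sub>m\<close> and leaves
  the prefixes that define the earlier roots unchanged, so the subword represents
  \<open>s\<^bsub>b\<^sub>1\<^esub> \<cdots> s\<^bsub>b\<^sub>m\<^esub> w\<close> (\<open>sub_elem_eq_reflection_product\<close>). With \<open>y = w x\<close>, the equation for \<open>x\<close>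
  becomes \<open>s\<^bsub>b\<^sub>1\<^esub> \<cdots> s\<^bsub>b\<^sub>m\<^esub> y = - y\<close>.

  Apply these reflections to \<open>y\<close> one after the other, starting with \<open>s\<^bsub>b\<^sub>m\<^esub>\<close>. The step with \<open>b\<^sub>k\<close> subtracts
  some multiple \<open>c\<^sub>k b\<^sub>k\<close>, so the product sends \<open>y\<close> to \<open>y - \<Sum> c\<^sub>k b\<^sub>k\<close>, and it sends \<open>y\<close> to \<open>- y\<close> exactly
  if \<open>y = 1/2 \<Sum> c\<^sub>k b\<^sub>k\<close>. Substituting this value of \<open>y\<close> into the formula that defines \<open>c\<^sub>k\<close> cancels
  the diagonal term and leaves \<open>\<Sum>\<^sub>l c\<^sub>l M\<^sub>k\<^sub>l = 0\<close> with \<open>M\<close> the skew-symmetric matrix of the theorem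
  (\<open>half_sum_recursion\<close>). Hence \<open>c \<mapsto> w\<^sup>-\<^sup>1 (1/2 \<Sum> c\<^sub>k b\<^sub>k)\<close> is the isomorphism; its
  inverse reads off the coefficients \<open>c\<^sub>k\<close> (\<open>skew_kernel_to_fixed\<close>, \<open>fixed_to_skew_kernel\<close>). The
  argument concerns arbitrary nonzero vectors \<open>b\<^sub>k\<close> of a Euclidean space.

  What is special to root systems is that everything is defined over the rationals. Cartan
  integers make the inner products of simple roots rational up to the squared lengths of the simple
  roots, and these lengths have rational ratios as soon as the Dynkin diagram is connected; a root
  of squared length 2 then fixes the scale. Connectedness (\<open>simple_roots_connected\<close>) is the only
  consequence of the simplicity of the Lie algebra: for a disconnected diagram, no root involves
  simple roots of both parts, so the root spaces of the two parts commute, and the centraliser of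
  the root spaces of one part is a proper nonzero ideal.\<close>

section \<open>The eigenvalue -1 of a product of reflections\<close>

definition reflection_product :: "'e::euclidean_space list \<Rightarrow> 'e \<Rightarrow> 'e" where
  "reflection_product bs = compose_list (map reflection bs)"

text \<open>The multiple of \<open>bs ! k\<close> that is subtracted when the reflection in \<open>bs ! k\<close> is applied in the
  course of computing the product. The reflections of later list entries come first.\<close>

definition step_coeff :: "'e::euclidean_space list \<Rightarrow> 'e \<Rightarrow> nat \<Rightarrow> real" where
  "step_coeff bs y k = inner (reflection_product (drop (Suc k) bs) y) (coroot (bs ! k))"

lemma compose_list_simps [simp]:
  "compose_list [] = id"
  "compose_list (f # fs) = f \<circ> compose_list fs"
  "compose_list (fs @ gs) = compose_list fs \<circ> compose_list gs"
proof -
  show "compose_list (fs @ gs) = compose_list fs \<circ> compose_list gs"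
    by (induction fs) (simp_all add: compose_list_def comp_assoc)
qed (simp_all add: compose_list_def)

lemma reflection_product_drop:
  assumes "k \<le> length bs"
  shows "reflection_product (drop k bs) y
    = y - (\<Sum>l\<in>{k..<length bs}. step_coeff bs y l *\<^sub>R bs ! l)"
  using assms
proof (induction rule: inc_induct)
  case base
  show ?case by (simp add: reflection_product_def)
next
  case (step k)
  have "reflection_product (drop k bs) y = reflection (bs ! k) (reflection_product (drop (Suc k) bs) y)"
    using step.hyps by (simp add: reflection_product_def Cons_nth_drop_Suc [symmetric])
  also have "\<dots> = reflection_product (drop (Suc k) bs) y - step_coeff bs y k *\<^sub>R bs ! k"
    by (simp add: reflection_def step_coeff_def)
  finally show ?case
    using step by (simp add: sum.atLeast_Suc_lessThan algebra_simps)
qed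

text \<open>The coefficients are determined from the last one downwards, each by those with larger index.\<close>

lemma step_coeff_unique:
  assumes rec: "\<And>k. k < length bs \<Longrightarrow>
      c k = inner (y - (\<Sum>l\<in>{Suc k..<length bs}. c l *\<^sub>R bs ! l)) (coroot (bs ! k))"
    and "k < length bs"
  shows "c k = step_coeff bs y k"
  using assms(2)
proof (induction "length bs - k" arbitrary: k rule: less_induct)
  case less
  have "(\<Sum>l\<in>{Suc k..<length bs}. c l *\<^sub>R bs ! l)
      = (\<Sum>l\<in>{Suc k..<length bs}. step_coeff bs y l *\<^sub>R bs ! l)"
    using less by (intro sum.cong) auto
  then show ?case
    using rec [OF less.prems] less.prems reflection_product_drop [of "Suc k" bs y]
    by (simp add: step_coeff_def)
qed

text \<open>Entry \<open>k\<close> of the product of the skew-symmetric matrix of \<open>bs\<close> with the vector \<open>c\<close>.\<close>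

definition skew_row :: "'e::euclidean_space list \<Rightarrow> (nat \<Rightarrow> real) \<Rightarrow> nat \<Rightarrow> real" where
  "skew_row bs c k = (\<Sum>l\<in>{Suc k..<length bs}. c l * inner (bs ! k) (bs ! l))
     - (\<Sum>l<k. c l * inner (bs ! l) (bs ! k))"

lemma skew_row_eq_sum:
  assumes "k < length bs"
  shows "skew_row bs c k = (\<Sum>l<length bs.
    (if k < l then inner (bs ! k) (bs ! l)
     else if l < k then - inner (bs ! l) (bs ! k) else 0) * c l)"
proof -
  have split: "{..<length bs} = {..<k} \<union> {k} \<union> {Suc k..<length bs}"
    using assms by auto
  have "{..<k} \<inter> {Suc k..<length bs} = {}" by auto
  then show ?thesis
    unfolding split
    by (subst sum.union_disjoint; force simp: skew_row_def sum_negf ac_simps)+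
qed

text \<open>If \<open>y\<close> is half of the combination, then the condition that \<open>c k\<close> is the step coefficient,
  multiplied by half of \<open>inner (bs ! k) (bs ! k)\<close>, has the term with index \<open>k\<close> on both sides.
  After cancelling it, the terms before \<open>k\<close> and those after \<open>k\<close> survive with opposite signs: this
  is where the skew-symmetry of the matrix comes from.\<close>

lemma half_sum_recursion:
  assumes "k < length bs" and "bs ! k \<noteq> 0"
    and y: "2 *\<^sub>R y = (\<Sum>l<length bs. c l *\<^sub>R bs ! l)"
  shows "c k = inner (y - (\<Sum>l\<in>{Suc k..<length bs}. c l *\<^sub>R bs ! l)) (coroot (bs ! k))
    \<longleftrightarrow> skew_row bs c k = 0"
proof -
  let ?b = "bs ! k"
  define L where "L = (\<Sum>l<k. c l * inner (bs ! l) ?b)"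
  define R where "R = (\<Sum>l\<in>{Suc k..<length bs}. c l * inner (bs ! l) ?b)"
  have split: "{..<length bs} = {..<k} \<union> {k} \<union> {Suc k..<length bs}"
    using assms(1) by auto
  have "2 * inner y ?b = inner (2 *\<^sub>R y) ?b" by simp
  also have "\<dots> = (\<Sum>l<length bs. c l * inner (bs ! l) ?b)"
    unfolding y by (simp add: inner_sum_left)
  also have "\<dots> = L + c k * inner ?b ?b + R"
    unfolding split L_def R_def by (subst sum.union_disjoint; force)+
  finally have yb: "2 * inner y ?b = L + c k * inner ?b ?b + R" .
  have skew: "skew_row bs c k = R - L"
    by (simp add: skew_row_def L_def R_def inner_commute)
  have N: "inner ?b ?b \<noteq> 0" using assms(2) by simp
  have "inner (y - (\<Sum>l\<in>{Suc k..<length bs}. c l *\<^sub>R bs ! l)) (coroot ?b)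
      = 2 * (inner y ?b - R) / inner ?b ?b"
    by (simp add: coroot_def inner_diff_left inner_sum_left R_def)
  also have "\<dots> = c k + (L - R) / inner ?b ?b"
    using yb N by (simp add: field_simps)
  finally show ?thesis
    using N by (auto simp: skew)
qed

lemma skew_kernel_to_fixed:
  assumes nz: "0 \<notin> set bs"
    and c: "\<And>k. k < length bs \<Longrightarrow> skew_row bs c k = 0"
    and y: "2 *\<^sub>R y = (\<Sum>l<length bs. c l *\<^sub>R bs ! l)"
  shows "reflection_product bs y = - y"
    and "\<And>k. k < length bs \<Longrightarrow> step_coeff bs y k = c k"
proof -
  show *: "step_coeff bs y k = c k" if "k < length bs" for k
  proof (rule step_coeff_unique [OF _ that, symmetric])
    fix l assume l: "l < length bs"
    then have "bs ! l \<noteq> 0" using nz nth_mem by metis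
    then show "c l = inner (y - (\<Sum>i\<in>{Suc l..<length bs}. c i *\<^sub>R bs ! i)) (coroot (bs ! l))"
      using half_sum_recursion [OF l _ y] c [OF l] by blast
  qed
  have "reflection_product bs y = y - 2 *\<^sub>R y"
    using reflection_product_drop [of 0 bs y] * by (simp add: y atLeast0LessThan)
  then show "reflection_product bs y = - y"
    by (simp add: scaleR_2)
qed

lemma fixed_to_skew_kernel:
  assumes nz: "0 \<notin> set bs" and fixed: "reflection_product bs y = - y"
  shows "2 *\<^sub>R y = (\<Sum>l<length bs. step_coeff bs y l *\<^sub>R bs ! l)"
    and "\<And>k. k < length bs \<Longrightarrow> skew_row bs (step_coeff bs y) k = 0"
proof -
  have "- y = y - (\<Sum>l<length bs. step_coeff bs y l *\<^sub>R bs ! l)"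
    using reflection_product_drop [of 0 bs y] fixed by (simp add: atLeast0LessThan)
  then show y: "2 *\<^sub>R y = (\<Sum>l<length bs. step_coeff bs y l *\<^sub>R bs ! l)"
    by (simp add: scaleR_2 algebra_simps)
  show "skew_row bs (step_coeff bs y) k = 0" if k: "k < length bs" for k
  proof -
    have "bs ! k \<noteq> 0" using nz k nth_mem by metis
    moreover have "step_coeff bs y k =
        inner (y - (\<Sum>l\<in>{Suc k..<length bs}. step_coeff bs y l *\<^sub>R bs ! l)) (coroot (bs ! k))"
      using reflection_product_drop [of "Suc k" bs y] k by (simp add: step_coeff_def [of bs y k])
    ultimately show ?thesis using half_sum_recursion [OF k _ y] by blast
  qed
qed

section \<open>Subwords as products of reflections\<close>

lemma linear_reflection: "linear (reflection a)"
  by (rule linearI) (simp_all add: reflection_def algebra_simps inner_add_left)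

lemma reflection_reflection [simp]: "reflection a (reflection a x) = x"
  by (cases "a = 0") (simp_all add: reflection_def coroot_def algebra_simps inner_diff_left)

lemma inner_reflection [simp]: "inner (reflection a x) (reflection a y) = inner x y"
  by (cases "a = 0")
    (simp_all add: reflection_def coroot_def algebra_simps inner_diff_left inner_diff_right
      inner_commute)

lemma word_elem_simps [simp]:
  "word_elem \<alpha> [] = id"
  "word_elem \<alpha> (j # js) = reflection (\<alpha> j) \<circ> word_elem \<alpha> js"
  "word_elem \<alpha> (js @ js') = word_elem \<alpha> js \<circ> word_elem \<alpha> js'"
  by (simp_all add: word_elem_def)

lemma linear_word_elem: "linear (word_elem \<alpha> js)"
  by (induction js) (auto simp del: o_apply simp: id_def [symmetric]
      intro!: linear_compose linear_reflection linear_id)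

lemma inner_word_elem [simp]: "inner (word_elem \<alpha> js x) (word_elem \<alpha> js y) = inner x y"
  by (induction js) simp_all

lemma word_elem_rev [simp]:
  "word_elem \<alpha> (rev js) (word_elem \<alpha> js x) = x"
  "word_elem \<alpha> js (word_elem \<alpha> (rev js) x) = x"
  by (induction js arbitrary: x) simp_all

lemma reflection_word_elem:
  "reflection (word_elem \<alpha> js a) (word_elem \<alpha> js x) = word_elem \<alpha> js (reflection a x)"
  by (simp add: reflection_def coroot_def linear_diff [OF linear_word_elem]
      linear_scale [OF linear_word_elem])

text \<open>Adding a letter \<open>j\<close> at the end of the word keeps the earlier \<open>beta\<close>. If the new letter is
  deleted, the reflection in the new root \<open>word_elem \<alpha> js (\<alpha> j)\<close> undoes it, because it is the conjugate
  of the reflection in \<open>\<alpha> j\<close> by \<open>word_elem \<alpha> js\<close>.\<close>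

lemma sub_elem_eq_reflection_product:
  "sub_elem \<alpha> js \<Delta> x =
    reflection_product (map (beta \<alpha> js) (filter (\<lambda>k. k \<notin> \<Delta>) [1..<length js + 1])) (word_elem \<alpha> js x)"
proof (induction js arbitrary: x rule: rev_induct)
  case Nil
  show ?case by (simp add: sub_elem_def reflection_product_def)
next
  case (snoc j js)
  let ?n = "length js"
  have sub: "sub_elem \<alpha> (js @ [j]) \<Delta> x =
      sub_elem \<alpha> js \<Delta> (if Suc ?n \<in> \<Delta> then reflection (\<alpha> j) x else x)"
  proof -
    have "map (\<lambda>k. if k \<in> \<Delta> then reflection (\<alpha> ((js @ [j]) ! (k - 1))) else id) [1..<?n + 1]
      = map (\<lambda>k. if k \<in> \<Delta> then reflection (\<alpha> (js ! (k - 1))) else id) [1..<?n + 1]"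
      by (rule map_cong) (auto simp: nth_append)
    then show ?thesis by (simp add: sub_elem_def del: map_eq_conv)
  qed
  have beta: "map (beta \<alpha> (js @ [j])) (filter (\<lambda>k. k \<notin> \<Delta>) [1..<?n + 1])
    = map (beta \<alpha> js) (filter (\<lambda>k. k \<notin> \<Delta>) [1..<?n + 1])"
    by (rule map_cong) (auto simp: beta_def nth_append)
  have last: "beta \<alpha> (js @ [j]) (Suc ?n) = word_elem \<alpha> js (\<alpha> j)"
    by (simp add: beta_def)
  have prod_append: "reflection_product (bs @ [b]) y = reflection_product bs (reflection b y)"
    for bs :: "'a list" and b y
    by (simp add: reflection_product_def)
  show ?case
    using beta by (simp add: sub snoc.IH last prod_append reflection_word_elem del: map_eq_conv)
qed

lemma sorted_list_of_complement:
  "sorted_list_of_set ({1..n} - \<Delta>) = filter (\<lambda>k. k \<notin> \<Delta>) [1..<n + 1]"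
proof -
  have "{1..n} - \<Delta> = set (filter (\<lambda>k. k \<notin> \<Delta>) [1..<n + 1])" by auto
  then show ?thesis
    by (metis distinct_filter distinct_upt sorted_list_of_set.idem_if_sorted_distinct
        sorted_upt sorted_wrt_filter)
qed

section \<open>Simplicity and the linkage of roots\<close>

context complex_lie_algebra
begin

lemma lie_zero_left [simp]: "lie 0 x = 0"
  using lie_add_left [of 0 0 x] by simp

lemma lie_zero_right [simp]: "lie x 0 = 0"
  using lie_add_right [of x 0 0] by simp

lemma lie_anticommute: "lie x y = - lie y x"
proof -
  have "lie x y + lie y x = lie (x + y) (x + y)"
    by (simp only: lie_add_left lie_add_right) (simp add: lie_self add.commute)
  also have "\<dots> = 0" by (rule lie_self)
  finally show ?thesis by (simp add: eq_neg_iff_add_eq_0)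
qed

lemma lie_minus_right: "lie x (- y) = - lie x y"
  using lie_add_right [of x y "- y"] by (simp add: eq_neg_iff_add_eq_0 add.commute)

lemma lie_derivation: "lie x (lie y z) = lie (lie x y) z + lie y (lie x z)"
proof -
  have "lie y (lie z x) = - lie y (lie x z)"
    by (subst lie_anticommute [of z x]) (simp add: lie_minus_right)
  moreover have "lie z (lie x y) = - lie (lie x y) z"
    by (rule lie_anticommute)
  ultimately show ?thesis
    using jacobi [of x y z] by (simp add: algebra_simps)
qed

lemma lie_weight_space:
  assumes "x \<in> weight_space H \<mu>" "y \<in> weight_space H \<nu>"
  shows "lie x y \<in> weight_space H (\<lambda>h. \<mu> h + \<nu> h)"
  using assms
  by (auto simp: weight_space_def lie_derivation lie_scale_left lie_scale_right
      scale_left_distrib)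

lemma weight_space_cong:
  assumes "\<And>h. h \<in> H \<Longrightarrow> \<mu> h = \<nu> h"
  shows "weight_space H \<mu> = weight_space H \<nu>"
  using assms by (auto simp: weight_space_def)

lemma weight_zero_or_root:
  assumes "x \<in> weight_space H \<mu>" "x \<noteq> 0"
  shows "(\<forall>h\<in>H. \<mu> h = 0) \<or> (\<lambda>h. if h \<in> H then \<mu> h else 0) \<in> roots H"
proof -
  have "weight_space H (\<lambda>h. if h \<in> H then \<mu> h else 0) = weight_space H \<mu>"
    by (rule weight_space_cong) simp
  then show ?thesis using assms by (auto simp: roots_def)
qed

lemma simple_trivial_center:
  assumes "simple" and "\<And>x. lie x z = 0"
  shows "z = 0"
proof -
  let ?Z = "{z. \<forall>x. lie x z = 0}"
  have "ideal ?Z"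
    by (auto simp: ideal_def subspace_def lie_add_right lie_scale_right)
  moreover have "?Z \<noteq> UNIV"
    using assms(1) unfolding simple_def by blast
  ultimately have "?Z = {0}"
    using assms(1) unfolding simple_def by blast
  then show ?thesis using assms(2) by blast
qed

text \<open>Let \<open>C\<close> be the centraliser of the root spaces for \<open>Q\<close>. The Lie algebra is spanned by
  weight vectors, and bracketing with any of them preserves \<open>C\<close>, by the Jacobi identity: vectors of
  weight zero preserve the root spaces for \<open>Q\<close>, those with a root in \<open>P\<close> commute with them by
  the assumption on sums, and those with a root in \<open>Q\<close> kill \<open>C\<close>. So \<open>C\<close> is an ideal; it contains
  the root spaces for \<open>P\<close> and is therefore the whole algebra, which makes the root spaces for \<open>Q\<close>
  central.\<close>

lemma roots_linked_if_simple:
  assumes simple: "simple" and toral: "toral H"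
    and roots: "roots H = P \<union> Q" and "P \<noteq> {}" "Q \<noteq> {}"
    and sum: "\<And>\<mu> \<nu>. \<mu> \<in> P \<Longrightarrow> \<nu> \<in> Q \<Longrightarrow>
      (\<lambda>h. \<mu> h + \<nu> h) \<notin> roots H \<and> (\<exists>h\<in>H. \<mu> h + \<nu> h \<noteq> 0)"
  shows False
proof -
  define C where "C = {x. \<forall>\<nu>\<in>Q. \<forall>z\<in>weight_space H \<nu>. lie z x = 0}"
  have C_subspace: "subspace C"
    by (auto simp: C_def subspace_def lie_add_right lie_scale_right)
  have outside: "\<mu> h = 0" if "\<mu> \<in> roots H" "h \<notin> H" for \<mu> h
    using that by (auto simp: roots_def)
  have PQ: "lie z x = 0" if "\<mu> \<in> P" "x \<in> weight_space H \<mu>" "\<nu> \<in> Q" "z \<in> weight_space H \<nu>"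
    for \<mu> x \<nu> z
  proof (rule ccontr)
    assume nz: "lie z x \<noteq> 0"
    have "lie z x \<in> weight_space H (\<lambda>h. \<nu> h + \<mu> h)"
      using that lie_weight_space by blast
    from weight_zero_or_root [OF this nz] sum [OF that(1,3)]
    have "(\<lambda>h. if h \<in> H then \<nu> h + \<mu> h else 0) \<in> roots H"
      by (auto simp: add.commute)
    also have "(\<lambda>h. if h \<in> H then \<nu> h + \<mu> h else 0) = (\<lambda>h. \<mu> h + \<nu> h)"
      using outside [of \<mu>] outside [of \<nu>] that(1,3) roots by (auto simp: fun_eq_iff add.commute)
    finally show False using sum [OF that(1,3)] by blast
  qed
  have step: "lie v x \<in> C" if x: "x \<in> C" and v: "v \<in> weight_space H \<mu>" for v x \<mu>
  proof (cases "v = 0")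
    case True
    then show ?thesis by (simp add: C_def)
  next
    case False
    let ?\<mu> = "\<lambda>h. if h \<in> H then \<mu> h else 0"
    have v': "v \<in> weight_space H ?\<mu>"
      using v weight_space_cong [of H \<mu> ?\<mu>] by auto
    consider "\<forall>h\<in>H. \<mu> h = 0" | "?\<mu> \<in> P" | "?\<mu> \<in> Q"
      using weight_zero_or_root [OF v False] roots by blast
    then show ?thesis
    proof cases
      case 1
      show ?thesis unfolding C_def
      proof safe
        fix \<nu> z assume \<nu>: "\<nu> \<in> Q" and z: "z \<in> weight_space H \<nu>"
        have "lie z v \<in> weight_space H (\<lambda>h. \<nu> h + \<mu> h)"
          using lie_weight_space z v by blast
        also have "weight_space H (\<lambda>h. \<nu> h + \<mu> h) = weight_space H \<nu>"
          by (rule weight_space_cong) (simp add: 1)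
        finally have "lie z v \<in> weight_space H \<nu>" .
        then show "lie z (lie v x) = 0"
          using x \<nu> z by (simp add: C_def lie_derivation [of z v x])
      qed
    next
      case 2
      show ?thesis
        using x PQ [OF 2 v'] by (simp add: C_def lie_derivation [of _ v x])
    next
      case 3
      then show ?thesis using x v' by (simp add: C_def)
    qed
  qed
  have "ideal C"
    unfolding ideal_def
  proof (intro conjI allI ballI C_subspace)
    fix v x assume x: "x \<in> C"
    have "subspace {v. lie v x \<in> C}"
      using C_subspace by (auto simp: subspace_def lie_add_left lie_scale_left)
    moreover have "(\<Union>\<mu>. weight_space H \<mu>) \<subseteq> {v. lie v x \<in> C}"
      using step x by blast
    ultimately have "span (\<Union>\<mu>. weight_space H \<mu>) \<subseteq> {v. lie v x \<in> C}"
      by (intro span_minimal)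
    then show "lie v x \<in> C" using toral by (auto simp: toral_def)
  qed
  moreover have "C \<noteq> {0}"
  proof -
    obtain \<mu> where \<mu>: "\<mu> \<in> P" using \<open>P \<noteq> {}\<close> by blast
    then have "weight_space H \<mu> \<noteq> {0}" using roots by (auto simp: roots_def)
    moreover have "0 \<in> weight_space H \<mu>" by (simp add: weight_space_def)
    moreover have "weight_space H \<mu> \<subseteq> C" using PQ [OF \<mu>] by (auto simp: C_def)
    ultimately show ?thesis by blast
  qed
  ultimately have C: "C = UNIV"
    using simple unfolding simple_def by blast
  obtain \<nu> where \<nu>: "\<nu> \<in> Q" using \<open>Q \<noteq> {}\<close> by blast
  have "z = 0" if "z \<in> weight_space H \<nu>" for z
  proof (rule simple_trivial_center [OF simple])
    fix x
    have "lie z x = 0" using that \<nu> C by (auto simp: C_def)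
    then show "lie x z = 0" by (simp add: lie_anticommute [of x z])
  qed
  then have "weight_space H \<nu> = {0}" by (auto simp: weight_space_def)
  then show False using \<nu> roots by (auto simp: roots_def)
qed

end

section \<open>Irreducibility of the root system\<close>

lemma inner_zero_on_span:
  fixes v :: "'e::euclidean_space"
  assumes "\<And>s. s \<in> S \<Longrightarrow> inner v s = 0" and "x \<in> real_vector.span S"
  shows "inner v x = 0"
  using assms(2)
  by (induction rule: real_vector.span_induct_alt) (auto simp: assms(1) inner_add_right)

context simple_lie_roots
begin

lemma coeff_eq:
  assumes "(\<Sum>i\<in>UNIV. r i *\<^sub>R \<alpha> i) = (\<Sum>i\<in>UNIV. s i *\<^sub>R \<alpha> i)"
  shows "r = s"
proof
  fix i
  have "(\<Sum>i\<in>UNIV. (r i - s i) *\<^sub>R \<alpha> i) = 0"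
    using assms by (simp add: scaleR_diff_left sum_subtractf)
  moreover have "(\<Sum>i\<in>UNIV. (r i - s i) *\<^sub>R \<alpha> i)
      = (\<Sum>v\<in>range \<alpha>. (r (inv_into UNIV \<alpha> v) - s (inv_into UNIV \<alpha> v)) *\<^sub>R v)"
    by (subst sum.reindex [OF simple_inj]) (simp add: simple_inj)
  ultimately have "r (inv_into UNIV \<alpha> (\<alpha> i)) - s (inv_into UNIV \<alpha> (\<alpha> i)) = 0"
    using real_vector.independentD [OF simple_independent, of "range \<alpha>"
        "\<lambda>v. r (inv_into UNIV \<alpha> v) - s (inv_into UNIV \<alpha> v)" "\<alpha> i"] by auto
  then show "r i = s i" by (simp add: simple_inj)
qed

lemma simple_nonzero: "\<alpha> i \<noteq> 0"
  using simple_independent real_vector.dependent_zero by (metis rangeI)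

lemma root_simple: "ev (\<alpha> i) \<in> roots H"
  using simple_roots by auto

lemma ev_zero: "ev 0 h = 0"
  using ev_scaleR [of 0 0 h] by simp

lemma root_uminus:
  assumes "ev b \<in> roots H"
  shows "ev (- b) \<in> roots H"
proof (cases "b = 0")
  case True
  then show ?thesis using assms by simp
next
  case False
  then have "reflection b b = - b"
    by (simp add: reflection_def coroot_def scaleR_2)
  then show ?thesis using weyl_invariant [OF assms assms] by simp
qed

text \<open>Infinite descent on the height of the part of the root that lies in the span of \<open>A\<close>. This part has
  positive inner product with some simple root \<open>\<alpha> k\<close> in its support. The reflection in \<open>\<alpha> k\<close>
  lowers the coefficient of \<open>\<alpha> k\<close> and changes no other one; the result is again a positive root,
  since its coefficients outside \<open>A\<close> are unchanged. Its part in the span of \<open>A\<close> cannot vanish, because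
  reflections preserve length.\<close>

lemma positive_root_unmixed:
  fixes A :: "'i set" and c :: "'i \<Rightarrow> nat"
  assumes orth: "\<And>i j. i \<in> A \<Longrightarrow> j \<notin> A \<Longrightarrow> inner (\<alpha> i) (\<alpha> j) = 0"
    and "ev (\<Sum>i\<in>UNIV. real (c i) *\<^sub>R \<alpha> i) \<in> roots H"
    and "\<exists>i\<in>A. c i \<noteq> 0" and "\<exists>j. j \<notin> A \<and> c j \<noteq> 0"
  shows False
  using assms(2-)
proof (induction "\<Sum>i\<in>A. c i" arbitrary: c rule: less_induct)
  case less
  define b where "b = (\<Sum>i\<in>UNIV. real (c i) *\<^sub>R \<alpha> i)"
  define bA where "bA = (\<Sum>i\<in>A. real (c i) *\<^sub>R \<alpha> i)"
  obtain j where j: "j \<notin> A" "c j \<noteq> 0" using less.prems by blast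
  have bA_eq: "bA = (\<Sum>i\<in>UNIV. (if i \<in> A then real (c i) else 0) *\<^sub>R \<alpha> i)"
    unfolding bA_def by (rule sum.mono_neutral_cong_left) auto
  have "bA \<noteq> 0"
  proof
    assume "bA = 0"
    then have "(\<lambda>i. if i \<in> A then real (c i) else 0) = (\<lambda>_. 0)"
      using bA_eq by (intro coeff_eq) simp
    then show False using less.prems(2) by (metis of_nat_eq_0_iff)
  qed
  then have "0 < inner bA bA" by simp
  also have "inner bA bA = (\<Sum>i\<in>A. real (c i) * inner (\<alpha> i) bA)"
    by (subst (1) bA_def) (simp add: inner_sum_left)
  finally obtain k where k: "k \<in> A" "0 < real (c k) * inner (\<alpha> k) bA"
    by (meson not_le sum_nonpos)
  have kpos: "inner (\<alpha> k) bA > 0"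
    using k(2) by (simp add: zero_less_mult_iff)
  define p where "p = inner b (coroot (\<alpha> k))"
  have "inner b (\<alpha> k) = (\<Sum>i\<in>UNIV. real (c i) * inner (\<alpha> i) (\<alpha> k))"
    by (simp add: b_def inner_sum_left)
  also have "\<dots> = (\<Sum>i\<in>A. real (c i) * inner (\<alpha> i) (\<alpha> k))"
    by (intro sum.mono_neutral_right)
      (use orth [OF k(1)] in \<open>auto simp: inner_commute [of _ "\<alpha> k"]\<close>)
  also have "\<dots> = inner bA (\<alpha> k)"
    by (simp add: bA_def inner_sum_left)
  finally have p: "p = 2 * inner bA (\<alpha> k) / inner (\<alpha> k) (\<alpha> k)"
    by (simp add: p_def coroot_def)
  have p0: "p > 0"
    unfolding p using kpos simple_nonzero [of k] by (simp add: inner_commute)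
  define r where "r = (\<lambda>i. real (c i) - (if i = k then p else 0))"
  have refl: "reflection (\<alpha> k) b = (\<Sum>i\<in>UNIV. r i *\<^sub>R \<alpha> i)"
  proof -
    have "(\<Sum>i\<in>UNIV. (if i = k then p else 0) *\<^sub>R \<alpha> i) = (\<Sum>i\<in>UNIV. if i = k then p *\<^sub>R \<alpha> k else 0)"
      by (rule sum.cong) auto
    then show ?thesis
      by (simp add: r_def scaleR_diff_left sum_subtractf reflection_def p_def [symmetric])
        (simp add: b_def)
  qed
  have rroot: "ev (reflection (\<alpha> k) b) \<in> roots H"
    using weyl_invariant [OF root_simple] less.prems(1) by (simp add: b_def)
  from simple_base [OF rroot] obtain d :: "'i \<Rightarrow> nat" where
    "reflection (\<alpha> k) b = (\<Sum>i\<in>UNIV. real (d i) *\<^sub>R \<alpha> i) \<or>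
     reflection (\<alpha> k) b = (\<Sum>i\<in>UNIV. (- real (d i)) *\<^sub>R \<alpha> i)"
    by (auto simp: sum_negf)
  then have "r = (\<lambda>i. real (d i)) \<or> r = (\<lambda>i. - real (d i))"
    unfolding refl
    using coeff_eq [of r "\<lambda>i. real (d i)"] coeff_eq [of r "\<lambda>i. - real (d i)"] by argo
  moreover have "r j > 0" using j k(1) by (auto simp: r_def)
  ultimately have d: "\<And>i. r i = real (d i)"
    by auto
  have drop: "d i = c i" if "i \<noteq> k" for i
    using d [of i] that by (simp add: r_def)
  have "real (d k) < real (c k)"
    using d [of k] p0 by (simp add: r_def)
  then have dk: "d k < c k" by simp
  \<comment> \<open>Otherwise \<open>bA = p *\<^sub>R \<alpha> k\<close>, whose pairing with the coroot of \<open>\<alpha> k\<close> is both \<open>p\<close> and \<open>2 * p\<close>.\<close>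
  have "\<exists>i\<in>A. d i \<noteq> 0"
  proof (rule ccontr)
    assume "\<not> ?thesis"
    then have z: "\<And>i. i \<in> A \<Longrightarrow> d i = 0" by blast
    have "real (c k) = p" using d [of k] z [OF k(1)] by (simp add: r_def)
    moreover have "bA = real (c k) *\<^sub>R \<alpha> k"
    proof -
      have "bA = (\<Sum>i\<in>A. if i = k then real (c k) *\<^sub>R \<alpha> k else 0)"
        unfolding bA_def
      proof (rule sum.cong)
        fix i assume "i \<in> A"
        then show "real (c i) *\<^sub>R \<alpha> i = (if i = k then real (c k) *\<^sub>R \<alpha> k else 0)"
          using drop [of i] z [of i] by auto
      qed simp
      then show ?thesis using k(1) by simp
    qed
    ultimately have "p = 2 * p" using p simple_nonzero [of k] by simp
    then show False using p0 by simp
  qed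
  moreover have "(\<Sum>i\<in>A. d i) < (\<Sum>i\<in>A. c i)"
  proof (rule sum_strict_mono_ex1)
    show "\<forall>i\<in>A. d i \<le> c i" using drop dk by (metis le_less)
  qed (use dk k(1) in auto)
  moreover have "ev (\<Sum>i\<in>UNIV. real (d i) *\<^sub>R \<alpha> i) \<in> roots H"
    using rroot refl d by simp
  moreover have "\<exists>j. j \<notin> A \<and> d j \<noteq> 0"
    using j drop k(1) by metis
  ultimately show False using less.hyps by blast
qed

lemma root_unmixed:
  assumes orth: "\<And>i j. i \<in> A \<Longrightarrow> j \<notin> A \<Longrightarrow> inner (\<alpha> i) (\<alpha> j) = 0"
    and root: "ev (\<Sum>i\<in>UNIV. r i *\<^sub>R \<alpha> i) \<in> roots H"
  shows "(\<forall>i\<in>A. r i = 0) \<or> (\<forall>i. i \<notin> A \<longrightarrow> r i = 0)"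
proof -
  let ?b = "\<Sum>i\<in>UNIV. r i *\<^sub>R \<alpha> i"
  from simple_base [OF root] obtain c :: "'i \<Rightarrow> nat" where
    "?b = (\<Sum>i\<in>UNIV. real (c i) *\<^sub>R \<alpha> i) \<or> ?b = - (\<Sum>i\<in>UNIV. real (c i) *\<^sub>R \<alpha> i)"
    by blast
  then show ?thesis
  proof
    assume b: "?b = (\<Sum>i\<in>UNIV. real (c i) *\<^sub>R \<alpha> i)"
    then have "r = (\<lambda>i. real (c i))" by (rule coeff_eq)
    moreover have "\<not> ((\<exists>i\<in>A. c i \<noteq> 0) \<and> (\<exists>j. j \<notin> A \<and> c j \<noteq> 0))"
      using positive_root_unmixed [OF orth, of A c] root b by auto
    ultimately show ?thesis by auto
  next
    assume b: "?b = - (\<Sum>i\<in>UNIV. real (c i) *\<^sub>R \<alpha> i)"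
    then have "?b = (\<Sum>i\<in>UNIV. (- real (c i)) *\<^sub>R \<alpha> i)" by (simp add: sum_negf)
    then have "r = (\<lambda>i. - real (c i))" by (rule coeff_eq)
    moreover have "\<not> ((\<exists>i\<in>A. c i \<noteq> 0) \<and> (\<exists>j. j \<notin> A \<and> c j \<noteq> 0))"
      using positive_root_unmixed [OF orth, of A c] root_uminus [OF root] b by auto
    ultimately show ?thesis by auto
  qed
qed

lemma root_integer_combination:
  assumes "ev b \<in> roots H"
  obtains r where "\<And>i. r i \<in> \<int>" and "b = (\<Sum>i\<in>UNIV. r i *\<^sub>R \<alpha> i)"
proof -
  from simple_base [OF assms] obtain c :: "'i \<Rightarrow> nat" where
    "b = (\<Sum>i\<in>UNIV. real (c i) *\<^sub>R \<alpha> i) \<or> b = (\<Sum>i\<in>UNIV. (- real (c i)) *\<^sub>R \<alpha> i)"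
    by (auto simp: sum_negf)
  then show ?thesis
    using that [of "\<lambda>i. real (c i)"] that [of "\<lambda>i. - real (c i)"] by auto
qed

text \<open>The Dynkin diagram is connected. A proper union \<open>A\<close> of components would split the roots
  into two sets without mixed sums, which \<open>roots_linked_if_simple\<close> excludes.\<close>

lemma simple_roots_connected:
  assumes orth: "\<And>i j. i \<in> A \<Longrightarrow> j \<notin> A \<Longrightarrow> inner (\<alpha> i) (\<alpha> j) = 0"
    and "A \<noteq> {}"
  shows "A = UNIV"
proof (rule ccontr)
  assume "A \<noteq> UNIV"
  define comb where "comb r = (\<Sum>i\<in>UNIV. r i *\<^sub>R \<alpha> i)" for r
  define P where "P = {\<mu> \<in> roots H. \<exists>r. \<mu> = ev (comb r) \<and> (\<forall>i. i \<notin> A \<longrightarrow> r i = 0)}"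
  define Q where "Q = {\<mu> \<in> roots H. \<exists>r. \<mu> = ev (comb r) \<and> (\<forall>i\<in>A. r i = 0)}"
  have unit: "\<alpha> k = comb (\<lambda>i. if i = k then 1 else 0)" for k
  proof -
    have "comb (\<lambda>i. if i = k then 1 else 0) = (\<Sum>i\<in>UNIV. if i = k then \<alpha> k else 0)"
      unfolding comb_def by (rule sum.cong) auto
    then show ?thesis by simp
  qed
  have comb_zero: "comb r = 0 \<longleftrightarrow> r = (\<lambda>_. 0)" for r
    using coeff_eq [of r "\<lambda>_. 0"] by (auto simp: comb_def)
  have comb_add: "comb r + comb s = comb (\<lambda>i. r i + s i)" for r s
    by (simp add: comb_def scaleR_add_left sum.distrib)
  have nonzero: "\<mu> \<noteq> ev 0" if "\<mu> \<in> roots H" for \<mu>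
    using that ev_zero by (auto simp: roots_def)
  have toral: "toral H" using cartan by (simp add: cartan_def)
  show False
  proof (rule roots_linked_if_simple [OF simple toral, of P Q])
    show "roots H = P \<union> Q"
    proof
      show "roots H \<subseteq> P \<union> Q"
      proof
        fix \<mu> assume \<mu>: "\<mu> \<in> roots H"
        then obtain b where b: "\<mu> = ev b" using roots_in_range by blast
        with \<mu> obtain r where r: "\<mu> = ev (comb r)"
          using root_integer_combination [of b] unfolding comb_def by metis
        with root_unmixed [OF orth, of A r] \<mu> show "\<mu> \<in> P \<union> Q"
          by (auto simp: P_def Q_def comb_def)
      qed
    qed (auto simp: P_def Q_def)
    obtain k where "k \<in> A" using \<open>A \<noteq> {}\<close> by blast
    then have "ev (\<alpha> k) \<in> P"
      unfolding P_def using root_simple [of k] unit [of k] by (auto intro!: exI)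
    then show "P \<noteq> {}" by blast
    obtain l where "l \<notin> A" using \<open>A \<noteq> UNIV\<close> by blast
    then have "ev (\<alpha> l) \<in> Q"
      unfolding Q_def using root_simple [of l] unit [of l] by (auto intro!: exI)
    then show "Q \<noteq> {}" by blast
  next
    fix \<mu> \<nu> assume "\<mu> \<in> P" "\<nu> \<in> Q"
    then obtain r s where r: "\<mu> = ev (comb r)" "\<And>i. i \<notin> A \<Longrightarrow> r i = 0"
      and s: "\<nu> = ev (comb s)" "\<And>i. i \<in> A \<Longrightarrow> s i = 0"
      and roots: "\<mu> \<in> roots H" "\<nu> \<in> roots H"
      unfolding P_def Q_def by blast
    have sum: "(\<lambda>h. \<mu> h + \<nu> h) = ev (comb (\<lambda>i. r i + s i))"
      by (simp add: r s fun_eq_iff ev_add comb_add [symmetric])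
    obtain i where i: "r i \<noteq> 0"
      using nonzero [OF roots(1)] r(1) comb_zero [of r] by (auto simp: fun_eq_iff)
    then have iA: "i \<in> A" using r(2) by blast
    obtain j where j: "s j \<noteq> 0"
      using nonzero [OF roots(2)] s(1) comb_zero [of s] by (auto simp: fun_eq_iff)
    then have jA: "j \<notin> A" using s(2) by blast
    have "r i + s i \<noteq> 0" "r j + s j \<noteq> 0"
      using i j r(2) s(2) iA jA by simp_all
    then have "(\<lambda>h. \<mu> h + \<nu> h) \<notin> roots H"
      using root_unmixed [OF orth, of A "\<lambda>i. r i + s i"] iA jA
      unfolding sum comb_def by blast
    moreover have "\<exists>h\<in>H. \<mu> h + \<nu> h \<noteq> 0"
    proof (rule ccontr)
      assume "\<not> ?thesis"
      moreover have "\<mu> h + \<nu> h = 0" if "h \<notin> H" for h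
        using that roots by (simp add: roots_def)
      ultimately have "(\<lambda>h. \<mu> h + \<nu> h) = ev 0"
        by (auto simp: fun_eq_iff ev_zero)
      then have "comb (\<lambda>i. r i + s i) = 0"
        using ev_inj sum by (metis injD)
      then show False using comb_zero \<open>r i + s i \<noteq> 0\<close> by metis
    qed
    ultimately show "(\<lambda>h. \<mu> h + \<nu> h) \<notin> roots H \<and> (\<exists>h\<in>H. \<mu> h + \<nu> h \<noteq> 0)" by blast
  qed
qed

section \<open>Rational structures\<close>

text \<open>The reflection in \<open>\<alpha> i\<close> turns \<open>\<alpha> j\<close> into a root in which \<open>\<alpha> i\<close> has the negated Cartan number as
  its coefficient, and roots have integral coefficients.\<close>

lemma cartan_rational: "inner (\<alpha> j) (coroot (\<alpha> i)) \<in> \<rat>"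
proof (cases "i = j")
  case True
  then show ?thesis using simple_nonzero [of j] by (simp add: coroot_def)
next
  case False
  let ?c = "inner (\<alpha> j) (coroot (\<alpha> i))"
  define r where "r k = (if k = j then 1 else 0) - (if k = i then ?c else 0)" for k
  have "(\<Sum>k\<in>UNIV. r k *\<^sub>R \<alpha> k)
      = (\<Sum>k\<in>UNIV. (if k = j then \<alpha> j else 0) - (if k = i then ?c *\<^sub>R \<alpha> i else 0))"
    by (rule sum.cong) (auto simp: r_def scaleR_diff_left)
  then have r: "reflection (\<alpha> i) (\<alpha> j) = (\<Sum>k\<in>UNIV. r k *\<^sub>R \<alpha> k)"
    by (simp add: sum_subtractf reflection_def)
  obtain d where d: "\<And>k. d k \<in> \<int>" "reflection (\<alpha> i) (\<alpha> j) = (\<Sum>k\<in>UNIV. d k *\<^sub>R \<alpha> k)"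
    using root_integer_combination [OF weyl_invariant [OF root_simple [of i] root_simple [of j]]]
    by blast
  have "r = d" using r d(2) by (intro coeff_eq) simp
  then have "r i \<in> \<rat>" using d(1) Ints_subset_Rats by blast
  then show ?thesis using False by (simp add: r_def)
qed

lemma inner_simple_eq:
  "inner (\<alpha> i) (\<alpha> j) = inner (\<alpha> i) (coroot (\<alpha> j)) / 2 * inner (\<alpha> j) (\<alpha> j)"
  using simple_nonzero [of j] by (simp add: coroot_def)

text \<open>For two simple roots that are not orthogonal, the ratio of squared lengths is a quotient of two
  Cartan numbers. Connectedness extends rationality to all pairs.\<close>

lemma norm_ratio_rational: "inner (\<alpha> j) (\<alpha> j) / inner (\<alpha> i) (\<alpha> i) \<in> \<rat>"
proof -
  define A where "A = {j. inner (\<alpha> j) (\<alpha> j) / inner (\<alpha> i) (\<alpha> i) \<in> \<rat>}"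
  have "A = UNIV"
  proof (rule simple_roots_connected)
    have "i \<in> A" by (simp add: A_def)
    then show "A \<noteq> {}" by blast
  next
    fix j k assume j: "j \<in> A" and k: "k \<notin> A"
    show "inner (\<alpha> j) (\<alpha> k) = 0"
    proof (rule ccontr)
      assume nz: "inner (\<alpha> j) (\<alpha> k) \<noteq> 0"
      let ?p = "inner (\<alpha> j) (coroot (\<alpha> k))" and ?q = "inner (\<alpha> k) (coroot (\<alpha> j))"
      have eq: "?p * inner (\<alpha> k) (\<alpha> k) = ?q * inner (\<alpha> j) (\<alpha> j)"
        using inner_simple_eq [of j k] inner_simple_eq [of k j] by (simp add: inner_commute)
      have "?p \<noteq> 0" using nz inner_simple_eq [of j k] by auto
      then have "inner (\<alpha> k) (\<alpha> k) / inner (\<alpha> i) (\<alpha> i)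
          = ?q / ?p * (inner (\<alpha> j) (\<alpha> j) / inner (\<alpha> i) (\<alpha> i))"
        using eq simple_nonzero [of i] by (simp add: field_simps)
      also have "\<dots> \<in> \<rat>"
        using j unfolding A_def
        by (intro Rats_mult Rats_divide [OF cartan_rational cartan_rational]) simp
      finally show False using k by (simp add: A_def)
    qed
  qed
  then show ?thesis by (auto simp: A_def)
qed

text \<open>Expanding a root of squared length 2 in simple roots gives \<open>2 = q * inner (\<alpha> i) (\<alpha> i)\<close> with \<open>q\<close>
  rational.\<close>

lemma simple_norm_rational: "inner (\<alpha> i) (\<alpha> i) \<in> \<rat>"
proof -
  let ?N = "inner (\<alpha> i) (\<alpha> i)"
  obtain a where a: "ev a \<in> roots H" "norm a = sqrt 2" using short_exists by blast
  have aa: "inner a a = 2" using a(2) by (simp add: dot_square_norm)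
  obtain c where c: "\<And>k. c k \<in> \<int>" "a = (\<Sum>k\<in>UNIV. c k *\<^sub>R \<alpha> k)"
    using root_integer_combination [OF a(1)] by blast
  have "inner (\<alpha> k) a = (\<Sum>l\<in>UNIV. c l * inner (\<alpha> k) (\<alpha> l))" for k
    by (subst c(2)) (simp add: inner_sum_right)
  moreover have "inner a a = (\<Sum>k\<in>UNIV. c k * inner (\<alpha> k) a)"
    by (subst (1) c(2)) (simp add: inner_sum_left)
  ultimately have expand: "inner a a = (\<Sum>k\<in>UNIV. \<Sum>l\<in>UNIV. c k * (c l * inner (\<alpha> k) (\<alpha> l)))"
    by (simp add: sum_distrib_left)
  have "2 / ?N = (\<Sum>k\<in>UNIV. \<Sum>l\<in>UNIV. c k * (c l * (inner (\<alpha> k) (\<alpha> l) / ?N)))"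
    unfolding aa [symmetric] expand by (simp add: sum_divide_distrib)
  also have "\<dots> = (\<Sum>k\<in>UNIV. \<Sum>l\<in>UNIV. c k * (c l *
      (inner (\<alpha> k) (coroot (\<alpha> l)) / 2 * (inner (\<alpha> l) (\<alpha> l) / ?N))))"
    by (subst inner_simple_eq) simp
  also have "\<dots> \<in> \<rat>"
    using c(1) Ints_subset_Rats
    by (intro Rats_sum Rats_mult Rats_divide [OF cartan_rational Rats_number_of]
        norm_ratio_rational) auto
  finally have "2 / (2 / ?N) \<in> \<rat>" by (rule Rats_divide [OF Rats_number_of])
  then show ?thesis by simp
qed

lemma gram_rational: "inner (\<alpha> i) (\<alpha> j) \<in> \<rat>"
  by (subst inner_simple_eq) (intro Rats_mult Rats_divide cartan_rational simple_norm_rational, simp)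

lemma eq_if_coroot_inner_eq:
  assumes "\<And>i. inner u (coroot (\<alpha> i)) = inner v (coroot (\<alpha> i))"
  shows "u = v"
proof -
  have "inner (u - v) x = 0" if "x \<in> range \<alpha>" for x
    using that assms simple_nonzero by (auto simp: coroot_def inner_diff_left)
  then have "inner (u - v) (u - v) = 0"
    using inner_zero_on_span [of "range \<alpha>" "u - v" "u - v"] simple_spanning by blast
  then show ?thesis by simp
qed

definition rat_root_span :: "'e set" where
  "rat_root_span = {b. \<exists>q. (\<forall>i. q i \<in> \<rat>) \<and> b = (\<Sum>i\<in>UNIV. q i *\<^sub>R \<alpha> i)}"

text \<open>Existence of the dual basis is the Riesz representation, by \<open>v\<close>, of the linear functional \<open>g\<close> that
  picks out the coefficient of \<open>\<alpha> j\<close>, scaled to match the coroot.\<close>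

lemma fundamental_weight_eq:
  "inner (fundamental_weight \<alpha> j) (coroot (\<alpha> i)) = (if i = j then 1 else 0)"
proof -
  let ?P = "\<lambda>v. \<forall>i. inner v (coroot (\<alpha> i)) = (if i = j then 1 else 0)"
  obtain g :: "'e \<Rightarrow> real" where g: "linear g"
    "\<And>i. g (\<alpha> i) = (if i = j then inner (\<alpha> j) (\<alpha> j) / 2 else 0)"
  proof -
    obtain g :: "'e \<Rightarrow> real" where "linear g"
      "\<forall>x\<in>range \<alpha>. g x = (if x = \<alpha> j then inner (\<alpha> j) (\<alpha> j) / 2 else 0)"
      using real_vector.linear_independent_extend [OF simple_independent,
          where f = "\<lambda>x. if x = \<alpha> j then inner (\<alpha> j) (\<alpha> j) / 2 else 0"] by blast
    then show ?thesis using that [of g] by (simp add: inj_eq [OF simple_inj])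
  qed
  define v where "v = (\<Sum>b\<in>Basis. g b *\<^sub>R b)"
  have v: "inner v x = g x" for x
  proof -
    have "g x = g (\<Sum>b\<in>Basis. inner x b *\<^sub>R b)" by (simp add: euclidean_representation)
    also have "\<dots> = (\<Sum>b\<in>Basis. inner x b * g b)"
      by (simp add: linear_sum [OF g(1)] linear_scale [OF g(1)])
    finally show ?thesis by (simp add: v_def inner_sum_left inner_commute [of x] mult.commute)
  qed
  have "?P v"
    using simple_nonzero by (auto simp: coroot_def v g(2))
  moreover have "u = v" if "?P u" for u
    using that \<open>?P v\<close> by (intro eq_if_coroot_inner_eq) simp
  ultimately have "?P (fundamental_weight \<alpha> j)"
    unfolding fundamental_weight_def by (rule theI [of ?P])
  then show ?thesis by blast
qed

text \<open>Since squared lengths are rational, pairing with simple roots and pairing with simple coroots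
  detect the same rational structure.\<close>

lemma weight_rat_space_iff:
  "v \<in> weight_rat_space \<alpha> \<longleftrightarrow> (\<forall>i. inner v (\<alpha> i) \<in> \<rat>)"
proof -
  have inner_comb: "inner (\<Sum>j\<in>UNIV. c j *\<^sub>R fundamental_weight \<alpha> j) (coroot (\<alpha> i)) = c i" for c i
    by (simp add: inner_sum_left fundamental_weight_eq if_distrib cong: if_cong)
  have "inner v (\<alpha> i) \<in> \<rat> \<longleftrightarrow> inner v (coroot (\<alpha> i)) \<in> \<rat>" for i
  proof
    have half: "inner (\<alpha> i) (\<alpha> i) / 2 \<in> \<rat>"
      using simple_norm_rational [of i] by simp
    have "inner v (\<alpha> i) = inner v (coroot (\<alpha> i)) * (inner (\<alpha> i) (\<alpha> i) / 2)"
      using simple_nonzero [of i] by (simp add: coroot_def)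
    then show "inner v (\<alpha> i) \<in> \<rat>" if "inner v (coroot (\<alpha> i)) \<in> \<rat>"
      using Rats_mult [OF that half] by (simp only:)
    show "inner v (coroot (\<alpha> i)) \<in> \<rat>" if "inner v (\<alpha> i) \<in> \<rat>"
      using Rats_divide [OF that half] by (simp add: coroot_def mult.commute)
  qed
  moreover have "v \<in> weight_rat_space \<alpha> \<longleftrightarrow> (\<forall>i. inner v (coroot (\<alpha> i)) \<in> \<rat>)"
  proof
    assume "v \<in> weight_rat_space \<alpha>"
    then show "\<forall>i. inner v (coroot (\<alpha> i)) \<in> \<rat>"
      by (auto simp: weight_rat_space_def inner_comb)
  next
    assume "\<forall>i. inner v (coroot (\<alpha> i)) \<in> \<rat>"
    then have "\<forall>i. \<exists>q. inner v (coroot (\<alpha> i)) = real_of_rat q"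
      by (simp add: Rats_def image_iff)
    then obtain q where q: "\<And>i. inner v (coroot (\<alpha> i)) = real_of_rat (q i)" by metis
    have "v = (\<Sum>j\<in>UNIV. real_of_rat (q j) *\<^sub>R fundamental_weight \<alpha> j)"
      by (rule eq_if_coroot_inner_eq) (simp add: q inner_comb)
    then show "v \<in> weight_rat_space \<alpha>" by (auto simp: weight_rat_space_def)
  qed
  ultimately show ?thesis by simp
qed

lemma inner_rational:
  assumes "v \<in> weight_rat_space \<alpha>" "b \<in> rat_root_span"
  shows "inner v b \<in> \<rat>"
  using assms
  by (auto simp: weight_rat_space_iff rat_root_span_def inner_sum_right
      intro!: Rats_sum Rats_mult)

lemma rat_root_span_weight: "b \<in> rat_root_span \<Longrightarrow> b \<in> weight_rat_space \<alpha>"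
  by (auto simp: weight_rat_space_iff rat_root_span_def inner_sum_left
      intro!: Rats_sum Rats_mult gram_rational)

lemma inner_coroot_rational:
  assumes "v \<in> weight_rat_space \<alpha>" "b \<in> rat_root_span"
  shows "inner v (coroot b) \<in> \<rat>"
  using inner_rational [OF assms] inner_rational [OF rat_root_span_weight assms(2), of b] assms(2)
  by (simp add: coroot_def)

lemma simple_in_rat_root_span: "\<alpha> i \<in> rat_root_span"
proof -
  have "(\<Sum>k\<in>UNIV. (if k = i then 1 else 0) *\<^sub>R \<alpha> k) = (\<Sum>k\<in>UNIV. if k = i then \<alpha> i else 0)"
    by (rule sum.cong) auto
  then show ?thesis
    by (auto simp: rat_root_span_def intro!: exI [of _ "\<lambda>k. if k = i then 1 else 0"])
qed

lemma rat_root_span_diff_scale: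
  assumes "a \<in> rat_root_span" "b \<in> rat_root_span" "q \<in> \<rat>"
  shows "a - q *\<^sub>R b \<in> rat_root_span"
proof -
  obtain r s where "\<And>i. r i \<in> \<rat>" "\<And>i. s i \<in> \<rat>" "a = (\<Sum>i\<in>UNIV. r i *\<^sub>R \<alpha> i)"
    "b = (\<Sum>i\<in>UNIV. s i *\<^sub>R \<alpha> i)"
    using assms(1,2) by (auto simp: rat_root_span_def)
  then show ?thesis using assms(3)
    by (auto simp: rat_root_span_def scaleR_sum_right sum_subtractf [symmetric]
        scaleR_diff_left intro!: exI [of _ "\<lambda>i. r i - q * s i"])
qed

lemma word_elem_rat_root_span:
  assumes "b \<in> rat_root_span"
  shows "word_elem \<alpha> js b \<in> rat_root_span"
  by (induction js)
    (auto simp: assms reflection_def intro!: rat_root_span_diff_scale simple_in_rat_root_span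
      inner_coroot_rational rat_root_span_weight)

lemma reflection_weight:
  assumes "v \<in> weight_rat_space \<alpha>" "b \<in> rat_root_span"
  shows "reflection b v \<in> weight_rat_space \<alpha>"
  using inner_coroot_rational [OF assms] assms rat_root_span_weight [OF assms(2)]
  by (auto simp: weight_rat_space_iff reflection_def inner_diff_left)

lemma word_elem_weight:
  "v \<in> weight_rat_space \<alpha> \<Longrightarrow> word_elem \<alpha> js v \<in> weight_rat_space \<alpha>"
  by (induction js) (auto intro: reflection_weight simple_in_rat_root_span)

lemma reflection_product_weight:
  assumes "set bs \<subseteq> rat_root_span" "v \<in> weight_rat_space \<alpha>"
  shows "reflection_product bs v \<in> weight_rat_space \<alpha>"
  using assms by (induction bs) (auto simp: reflection_product_def intro: reflection_weight)

lemma step_coeff_rational: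
  assumes "set bs \<subseteq> rat_root_span" "v \<in> weight_rat_space \<alpha>" "k < length bs"
  shows "step_coeff bs v k \<in> \<rat>"
  unfolding step_coeff_def using assms nth_mem [OF assms(3)] set_drop_subset [of "Suc k" bs]
  by (intro inner_coroot_rational reflection_product_weight) auto

lemma half_combination_weight:
  assumes "set bs \<subseteq> rat_root_span" "\<And>l. l < length bs \<Longrightarrow> c l \<in> \<rat>"
  shows "(1 / 2) *\<^sub>R (\<Sum>l<length bs. c l *\<^sub>R bs ! l) \<in> weight_rat_space \<alpha>"
  unfolding weight_rat_space_iff
proof
  fix i
  have "inner (bs ! l) (\<alpha> i) \<in> \<rat>" if "l < length bs" for l
    using assms(1) nth_mem [OF that] simple_in_rat_root_span
    by (intro inner_rational rat_root_span_weight) auto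
  then show "inner ((1 / 2) *\<^sub>R (\<Sum>l<length bs. c l *\<^sub>R bs ! l)) (\<alpha> i) \<in> \<rat>"
    using assms(2) by (auto simp: inner_sum_left intro!: Rats_sum Rats_divide)
qed

section \<open>The isomorphism\<close>

text \<open>The correspondence between the kernel and the vectors \<open>y\<close> negated by the product, restricted to
  rational coefficients and composed with \<open>y = word_elem \<alpha> js x\<close>; reversing the word inverts it.\<close>

lemma mat_kernel_isomorphic_fixed:
  fixes M :: "rat mat"
  assumes bs: "set bs \<subseteq> rat_root_span" "0 \<notin> set bs"
    and dim: "dim_row M = length bs" "dim_col M = length bs"
    and M: "\<And>v k. k < length bs \<Longrightarrow> dim_vec v = length bs \<Longrightarrow>
      real_of_rat ((M *\<^sub>v v) $ k) = skew_row bs (\<lambda>l. real_of_rat (v $ l)) k"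
  shows "rat_isomorphic (mat_kernel M)
    {x \<in> weight_rat_space \<alpha>. reflection_product bs (word_elem \<alpha> js x) = - word_elem \<alpha> js x}"
    (is "rat_isomorphic ?K ?F")
proof -
  let ?m = "length bs"
  define half :: "rat Matrix.vec \<Rightarrow> 'e" where
    "half v = (1 / 2) *\<^sub>R (\<Sum>l<?m. real_of_rat (v $ l) *\<^sub>R bs ! l)" for v
  define f where "f v = word_elem \<alpha> (rev js) (half v)" for v
  have half2: "2 *\<^sub>R half v = (\<Sum>l<?m. real_of_rat (v $ l) *\<^sub>R bs ! l)" for v
    by (simp add: half_def)
  have K: "v \<in> ?K \<longleftrightarrow> dim_vec v = ?m \<and> (\<forall>k<?m. skew_row bs (\<lambda>l. real_of_rat (v $ l)) k = 0)" for v
  proof -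
    have "M *\<^sub>v v = 0\<^sub>v ?m \<longleftrightarrow> (\<forall>k<?m. (M *\<^sub>v v) $ k = 0)"
    proof
      assume "\<forall>k<?m. (M *\<^sub>v v) $ k = 0"
      then show "M *\<^sub>v v = 0\<^sub>v ?m"
        by (intro eq_vecI) (simp_all add: dim del: index_mult_mat_vec)
    next
      assume zero: "M *\<^sub>v v = 0\<^sub>v ?m"
      show "\<forall>k<?m. (M *\<^sub>v v) $ k = 0" unfolding zero by simp
    qed
    moreover have "v \<in> ?K \<longleftrightarrow> dim_vec v = ?m \<and> M *\<^sub>v v = 0\<^sub>v ?m"
      by (simp only: mat_kernel_def carrier_dim_vec dim mem_Collect_eq)
    moreover have "(M *\<^sub>v v) $ k = 0 \<longleftrightarrow> skew_row bs (\<lambda>l. real_of_rat (v $ l)) k = 0"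
      if "dim_vec v = ?m" "k < ?m" for k
      unfolding M [OF that(2,1), symmetric] by (simp del: index_mult_mat_vec)
    ultimately show ?thesis by blast
  qed
  have coeff: "step_coeff bs (half v) k = real_of_rat (v $ k)" if "v \<in> ?K" "k < ?m" for v k
    using skew_kernel_to_fixed(2) [OF bs(2) _ half2 that(2)] that(1) K by blast
  have "inj_on f ?K"
  proof (rule inj_onI)
    fix u v assume u: "u \<in> ?K" and v: "v \<in> ?K" and "f u = f v"
    then have "half u = half v" unfolding f_def by (metis word_elem_rev(2))
    then have "u $ k = v $ k" if "k < ?m" for k
      using coeff [OF u that] coeff [OF v that] by simp
    then show "u = v" using u v K by (intro eq_vecI) auto
  qed
  moreover have "f ` ?K = ?F"
  proof
    show "f ` ?K \<subseteq> ?F"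
    proof safe
      fix v assume v: "v \<in> ?K"
      show "f v \<in> weight_rat_space \<alpha>"
        unfolding f_def half_def
        by (intro word_elem_weight half_combination_weight bs) simp
      show "reflection_product bs (word_elem \<alpha> js (f v)) = - word_elem \<alpha> js (f v)"
        using skew_kernel_to_fixed(1) [OF bs(2) _ half2] v K unfolding f_def by simp
    qed
    show "?F \<subseteq> f ` ?K"
    proof
      fix x assume x: "x \<in> ?F"
      define y where "y = word_elem \<alpha> js x"
      have y: "y \<in> weight_rat_space \<alpha>" "reflection_product bs y = - y"
        using x word_elem_weight by (auto simp: y_def)
      have "\<forall>k. \<exists>q. k < ?m \<longrightarrow> step_coeff bs y k = real_of_rat q"
        using step_coeff_rational [OF bs(1) y(1)] by (auto simp: Rats_def)
      then obtain q where q: "\<And>k. k < ?m \<Longrightarrow> step_coeff bs y k = real_of_rat (q k)" by metis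
      define v where "v = Matrix.vec ?m q"
      have vq: "real_of_rat (v $ k) = step_coeff bs y k" if "k < ?m" for k
        using q [OF that] that by (simp add: v_def)
      have "skew_row bs (\<lambda>l. real_of_rat (v $ l)) k = skew_row bs (step_coeff bs y) k"
        if "k < ?m" for k
        unfolding skew_row_def using that vq by simp
      then have "v \<in> ?K"
        using fixed_to_skew_kernel(2) [OF bs(2) y(2)] by (simp add: K) (simp add: v_def)
      moreover have "2 *\<^sub>R half v = 2 *\<^sub>R y"
        unfolding half2 fixed_to_skew_kernel(1) [OF bs(2) y(2)] using vq by simp
      then have "f v = x" by (simp add: f_def y_def)
      ultimately show "x \<in> f ` ?K" by blast
    qed
  qed
  moreover have "f (u + v) = f u + f v" if "u \<in> ?K" "v \<in> ?K" for u v
  proof -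
    have "half (u + v) = half u + half v"
      using that K by (simp add: half_def of_rat_add scaleR_add_left sum.distrib scaleR_add_right)
    then show ?thesis by (simp add: f_def linear_add [OF linear_word_elem])
  qed
  moreover have "f (q \<cdot>\<^sub>v u) = real_of_rat q *\<^sub>R f u" if "u \<in> ?K" for q u
  proof -
    have "half (q \<cdot>\<^sub>v u) = real_of_rat q *\<^sub>R half u"
      using that K by (simp add: half_def of_rat_mult scaleR_sum_right ac_simps)
    then show ?thesis by (simp add: f_def linear_scale [OF linear_word_elem])
  qed
  ultimately show ?thesis
    unfolding rat_isomorphic_def bij_betw_def by blast
qed

end

theorem theorem3p1:
  fixes scale :: "complex \<Rightarrow> 'g::ab_group_add \<Rightarrow> 'g"
    and lie :: "'g \<Rightarrow> 'g \<Rightarrow> 'g"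
    and H :: "'g set"
    and ev :: "'e::euclidean_space \<Rightarrow> 'g \<Rightarrow> complex"
    and \<alpha> :: "'i::finite \<Rightarrow> 'e"
    and w :: "'e \<Rightarrow> 'e"
    and js :: "'i list"
    and \<Delta> :: "nat set"
  assumes "simple_lie_roots scale lie H ev \<alpha>"
    and "w \<in> weyl_group \<alpha>"
    and "reduced_decomposition \<alpha> w js"
    and "\<Delta> \<subseteq> {1..length js}"
  shows "\<exists>M :: rat mat. map_mat real_of_rat M = skew_matrix \<alpha> js \<Delta> \<and>
    rat_isomorphic (mat_kernel M)
      {x \<in> weight_rat_space \<alpha>. w x + sub_elem \<alpha> js \<Delta> x = 0}"
proof -
  interpret simple_lie_roots scale lie H ev \<alpha> by (rule assms(1))
  define bs where "bs = map (beta \<alpha> js) (filter (\<lambda>k. k \<notin> \<Delta>) [1..<length js + 1])"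
  have w: "w = word_elem \<alpha> js"
    using assms(3) by (simp add: reduced_decomposition_def)
  have sub: "sub_elem \<alpha> js \<Delta> x = reflection_product bs (word_elem \<alpha> js x)" for x
    by (simp add: sub_elem_eq_reflection_product bs_def)
  have span: "set bs \<subseteq> rat_root_span"
    by (auto simp: bs_def beta_def intro: word_elem_rat_root_span simple_in_rat_root_span)
  have nonzero: "0 \<notin> set bs"
  proof
    assume "0 \<in> set bs"
    then obtain js' i where "word_elem \<alpha> js' (\<alpha> i) = 0"
      by (auto simp: bs_def beta_def)
    then have "\<alpha> i = 0" by (metis inner_eq_zero_iff inner_word_elem)
    then show False by (simp add: simple_nonzero)
  qed
  let ?e = "\<lambda>i l. if i < l then inner (bs ! i) (bs ! l)
      else if l < i then - inner (bs ! l) (bs ! i) else 0"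
  have skew: "skew_matrix \<alpha> js \<Delta> = mat (length bs) (length bs) (\<lambda>(i, l). ?e i l)"
    unfolding skew_matrix_def sorted_list_of_complement Let_def
    by (rule eq_matI) (auto simp: bs_def simp del: upt_Suc)
  have "inner (bs ! i) (bs ! l) \<in> \<rat>" if "i < length bs" "l < length bs" for i l
    using span nth_mem [OF that(1)] nth_mem [OF that(2)]
    by (intro inner_rational rat_root_span_weight) auto
  then have entry: "?e i l \<in> \<rat>" if "i < length bs" "l < length bs" for i l
    using that by simp
  have "\<exists>q. ?e i l = real_of_rat q" if "i < length bs" "l < length bs" for i l
    by (rule Rats_cases [OF entry [OF that]]) blast
  then obtain q where q: "\<And>i l. i < length bs \<Longrightarrow> l < length bs \<Longrightarrow> ?e i l = real_of_rat (q i l)"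
    by metis
  define M where "M = mat (length bs) (length bs) (\<lambda>(i, l). q i l)"
  have map: "map_mat real_of_rat M = skew_matrix \<alpha> js \<Delta>"
    unfolding skew M_def using q by (intro eq_matI) auto
  have "real_of_rat ((M *\<^sub>v v) $ k) = skew_row bs (\<lambda>l. real_of_rat (v $ l)) k"
    if "k < length bs" "dim_vec v = length bs" for v k
  proof -
    have "(M *\<^sub>v v) $ k = (\<Sum>l<length bs. q k l * v $ l)"
      using that by (simp add: M_def scalar_prod_def atLeast0LessThan)
    then have "real_of_rat ((M *\<^sub>v v) $ k)
        = (\<Sum>l<length bs. real_of_rat (q k l) * real_of_rat (v $ l))"
      by (simp add: of_rat_sum of_rat_mult)
    also have "\<dots> = skew_row bs (\<lambda>l. real_of_rat (v $ l)) k"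
      unfolding skew_row_eq_sum [OF that(1)]
      by (rule sum.cong) (simp_all only: q [OF that(1)] lessThan_iff)
    finally show ?thesis .
  qed
  then have "rat_isomorphic (mat_kernel M)
      {x \<in> weight_rat_space \<alpha>. reflection_product bs (word_elem \<alpha> js x) = - word_elem \<alpha> js x}"
    by (intro mat_kernel_isomorphic_fixed span nonzero) (simp_all add: M_def)
  then show ?thesis
    using map by (auto simp: w sub eq_neg_iff_add_eq_0 add.commute)
qed

end
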